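(* Define $\gamma:\mathbb{R}^{2\times3}\to\mathbb{R}^3$ by $$\gamma([a_1\ a_2\ a_3])=\big(\|a_2-a_3\|,\ \|a_3-a_1\|,\ \|a_1-a_2\|\big).$$ Then $\gamma$ is not $\mathrm{E}(2)$-bi-Lipschitz.
   Context: $\mathbb{R}^2$, $\mathbb{R}^3$ carry the euclidean norm and $\mathbb{R}^{2\times 3}$ the Frobenius norm; $d(x,y)=\|x-y\|$. The euclidean group $\mathrm{E}(2)$ consists of pairs $g=(P,q)$ with $P\in\mathrm{O}(2)$, $q\in\mathbb{R}^2$, acting on $\mathbb{R}^2$ by $g\cdot a=Pa+q$ and on $\mathbb{R}^{2\times3}$ columnwise. We write $d_{\mathrm{E}(2)}(A,B)=\min_{g\in\mathrm{E}(2)}\|g\cdot A-B\|$. A function $f:\mathbb{R}^{2\times3}\to\mathbb{R}^m$ is called $\mathrm{E}(2)$-bi-Lipschitz if there exist constants $C_1,C_2>0$ such that $C_1d_{\mathrm{E}(2)}(A,B)\le d(f(A),f(B))\le C_2d_{\mathrm{E}(2)}(A,B)$ for all $A,B\in\mathbb{R}^{2\times3}$. *)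

theory Defs
  imports "HOL-Analysis.Analysis"
begin

(* A 2x3 matrix A :: real^3^2 has rows A $ i (i :: 2) and columns column j A (j :: 3).
   The library norm on real^3^2 is the L2 norm of the L2 norms of the rows, that is,
   the Frobenius norm. *)

definition E2 :: "((real^2^2) \<times> (real^2)) set" where
  "E2 = {(P, q). orthogonal_matrix P}"

definition act_point :: "(real^2^2) \<times> (real^2) \<Rightarrow> real^2 \<Rightarrow> real^2" where
  "act_point g a = fst g *v a + snd g"

definition act :: "(real^2^2) \<times> (real^2) \<Rightarrow> real^3^2 \<Rightarrow> real^3^2" where
  "act g A = (\<chi> i j. act_point g (column j A) $ i)"

(* The infimum is a minimum, see dist_E2_attained below. *)
definition dist_E2 :: "real^3^2 \<Rightarrow> real^3^2 \<Rightarrow> real" where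
  "dist_E2 A B = (INF g\<in>E2. norm (act g A - B))"

definition E2_bi_Lipschitz :: "(real^3^2 \<Rightarrow> real^'m) \<Rightarrow> bool" where
  "E2_bi_Lipschitz f \<longleftrightarrow>
     (\<exists>C1 > 0. \<exists>C2 > 0. \<forall>A B.
        C1 * dist_E2 A B \<le> dist (f A) (f B) \<and> dist (f A) (f B) \<le> C2 * dist_E2 A B)"

definition side_lengths :: "real^3^2 \<Rightarrow> real^3" where
  "side_lengths A =
     vector [norm (column 2 A - column 3 A),
             norm (column 3 A - column 1 A),
             norm (column 1 A - column 2 A)]"

lemma norm_column_le: "norm (column j M) \<le> norm (M :: real^3^2)"
proof -
  have "(norm (column j M))\<^sup>2 = (\<Sum>i\<in>UNIV. (M $ i $ j)\<^sup>2)"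
    by (simp add: norm_vec_def L2_set_def column_def sum_nonneg)
  also have "\<dots> \<le> (\<Sum>i\<in>UNIV. (norm (M $ i))\<^sup>2)"
    by (intro sum_mono) (metis component_le_norm_cart abs_ge_zero power2_abs power_mono)
  also have "\<dots> = (norm M)\<^sup>2"
    by (simp add: norm_vec_def[of M] L2_set_def sum_nonneg)
  finally show ?thesis
    by (rule power2_le_imp_le) simp
qed

lemma column_act: "column j (act g A) = act_point g (column j A)"
  by (simp add: column_def act_def vec_eq_iff)

lemma norm_act_point_linear:
  assumes "orthogonal_matrix P"
  shows "norm (P *v (a :: real^2)) = norm a"
  using assms orthogonal_transformation_norm[of "(*v) P" a]
  by (simp add: orthogonal_transformation_matrix)

lemma compact_orthogonal_matrices: "compact {P :: real^2^2. orthogonal_matrix P}"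
proof -
  have "closed {P :: real^2^2. orthogonal_matrix P}"
    unfolding orthogonal_matrix_def transpose_def matrix_matrix_mult_def
    by (intro closed_Collect_conj closed_Collect_eq continuous_intros)
  moreover have "bounded {P :: real^2^2. orthogonal_matrix P}"
  proof (rule boundedI)
    fix P :: "real^2^2" assume "P \<in> {P. orthogonal_matrix P}"
    then have P: "orthogonal_matrix P" by simp
    have "norm (P $ i) = 1" for i
      using P by (simp add: orthogonal_matrix_orthonormal_rows row_def)
    then show "norm P \<le> sqrt 2"
      by (simp add: norm_vec_def[of P] L2_set_def)
  qed
  ultimately show ?thesis
    by (simp add: compact_eq_bounded_closed)
qed

lemma dist_E2_attained: "\<exists>g\<in>E2. dist_E2 A B = norm (act g A - B)"
proof -
  define F where "F g = norm (act g A - B)" for g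
  define R where "R = F (mat 1, 0) + norm (column 1 A) + norm (column 1 B)"
  define K where "K = {P :: real^2^2. orthogonal_matrix P} \<times> cball (0 :: real^2) R"
  have one: "(mat 1, 0) \<in> K"
    by (auto simp: K_def R_def F_def orthogonal_matrix_id)
  have cont: "continuous_on K F"
    unfolding F_def act_def act_point_def matrix_vector_mult_def
    by (simp, intro continuous_intros)
  have "compact K"
    unfolding K_def by (intro compact_Times compact_orthogonal_matrices compact_cball)
  then obtain g where g: "g \<in> K" "\<And>h. h \<in> K \<Longrightarrow> F g \<le> F h"
    using continuous_attains_inf[of K F] one cont by blast
  have min: "F g \<le> F h" if h: "h \<in> E2" for h
  proof (cases "h \<in> K")
    case True
    then show ?thesis by (rule g(2))
  next
    case False
    have P: "orthogonal_matrix (fst h)" using h by (auto simp: E2_def)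
    with False have "norm (snd h) > R" by (cases h) (auto simp: K_def)
    have "snd h = column 1 (act h A - B) - fst h *v column 1 A + column 1 B"
    proof -
      have "column 1 (act h A - B) = column 1 (act h A) - column 1 B"
        by (simp add: column_def vec_eq_iff)
      then show ?thesis by (simp add: column_act act_point_def)
    qed
    then have "norm (snd h) \<le> norm (column 1 (act h A - B)) + norm (fst h *v column 1 A) + norm (column 1 B)"
      by (smt (verit) norm_triangle_ineq norm_triangle_ineq4)
    also have "\<dots> \<le> F h + norm (column 1 A) + norm (column 1 B)"
      unfolding F_def using norm_column_le[of 1 "act h A - B"] norm_act_point_linear[OF P]
      by simp
    finally have "F (mat 1, 0) < F h"
      using \<open>norm (snd h) > R\<close> by (simp add: R_def)
    with g(2)[OF one] show ?thesis by simp
  qed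
  have gE: "g \<in> E2" using g(1) by (auto simp: K_def E2_def)
  have "(INF h\<in>E2. F h) = F g"
    using gE min by (intro cInf_eq_minimum) auto
  then show ?thesis
    using gE by (auto simp: dist_E2_def F_def)
qed

end

theory Submission
  imports Defs
begin

text \<open>
  The lower Lipschitz bound fails at a degenerate triangle whose third vertex is the midpoint of
  the other two. Moving that vertex a distance \<open>t\<close> orthogonally to the line changes the
  side lengths only by \<open>O(t\<^sup>2)\<close>, while the displacement of the third vertex from the
  midpoint, which is equivariant and vanishes on the orbit of the degenerate triangle, forces the
  distance modulo isometries to be at least \<open>t / 2\<close>.
\<close>

definition midpoint_defect :: "real^3^2 \<Rightarrow> real^2" where
  "midpoint_defect A = column 3 A - (1/2) *\<^sub>R (column 1 A + column 2 A)"

lemma midpoint_defect_diff: "midpoint_defect (A - B) = midpoint_defect A - midpoint_defect B"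
  by (simp add: midpoint_defect_def column_def vec_eq_iff field_simps)

text \<open>The factor 2 is the sum 1 + 1/2 + 1/2 of the absolute weights of the columns, each
  column being bounded by the Frobenius norm.\<close>

lemma norm_midpoint_defect_le: "norm (midpoint_defect A) \<le> 2 * norm A"
proof -
  have "norm (midpoint_defect A)
      \<le> norm (column 3 A) + (1/2) * norm (column 1 A + column 2 A)"
    unfolding midpoint_defect_def
    using norm_triangle_ineq4[of "column 3 A" "(1/2) *\<^sub>R (column 1 A + column 2 A)"] by simp
  also have "\<dots> \<le> norm (column 3 A) + (1/2) * (norm (column 1 A) + norm (column 2 A))"
    by (simp add: norm_triangle_ineq)
  also have "\<dots> \<le> norm A + (1/2) * (norm A + norm A)"
    by (intro add_mono mult_left_mono norm_column_le) simp
  also have "\<dots> = 2 * norm A" by simp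
  finally show ?thesis .
qed

text \<open>The weights 1, -1/2, -1/2 sum to zero, so the translation part cancels.\<close>

lemma midpoint_defect_act: "midpoint_defect (act g A) = fst g *v midpoint_defect A"
  by (simp add: midpoint_defect_def column_act act_point_def matrix_vector_mult_diff_distrib
      matrix_vector_mult_scaleR vec.add vec_eq_iff field_simps)

text \<open>A minimising \<open>g\<close> keeps the defect of \<open>A\<close> at zero, so by
  linearity the defect of \<open>act g A - B\<close> comes from \<open>B\<close> alone.\<close>

lemma norm_midpoint_defect_le_dist_E2:
  assumes "midpoint_defect A = 0"
  shows "norm (midpoint_defect B) \<le> 2 * dist_E2 A B"
proof -
  obtain g where g: "dist_E2 A B = norm (act g A - B)"
    using dist_E2_attained by blast
  have "midpoint_defect (act g A - B) = - midpoint_defect B"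
    using assms by (simp add: midpoint_defect_diff midpoint_defect_act)
  then show ?thesis
    using norm_midpoint_defect_le[of "act g A - B"] g by simp
qed

text \<open>The inner vectors are rows; the vertices are the columns (-1, 0), (1, 0) and the apex
  (0, t).\<close>

definition isosceles :: "real \<Rightarrow> real^3^2" where
  "isosceles t = vector [vector [-1, 1, 0], vector [0, 0, t]]"

lemma norm_midpoint_defect_isosceles: "norm (midpoint_defect (isosceles t)) = \<bar>t\<bar>"
  by (simp add: midpoint_defect_def isosceles_def column_def norm_vec_def L2_set_def sum_2)

lemma side_lengths_isosceles:
  "side_lengths (isosceles t) = vector [sqrt (1 + t\<^sup>2), sqrt (1 + t\<^sup>2), 2]"
  by (simp add: side_lengths_def isosceles_def column_def norm_vec_def L2_set_def sum_2)

text \<open>Only the two equal legs change, each by at most half of \<open>t\<^sup>2\<close>, since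
  the square root is concave.\<close>

lemma dist_side_lengths_isosceles:
  "dist (side_lengths (isosceles 0)) (side_lengths (isosceles t)) \<le> t\<^sup>2"
proof -
  have "sqrt (1 + t\<^sup>2) \<le> 1 + t\<^sup>2 / 2"
    by (rule real_le_lsqrt) (simp_all add: power2_sum power_divide)
  moreover have "1 \<le> sqrt (1 + t\<^sup>2)" by simp
  moreover have "dist (side_lengths (isosceles 0)) (side_lengths (isosceles t))
      \<le> 2 * \<bar>1 - sqrt (1 + t\<^sup>2)\<bar>"
    unfolding dist_norm
    by (rule order_trans[OF norm_le_l1_cart]) (simp add: side_lengths_isosceles sum_3)
  ultimately show ?thesis by simp
qed

theorem mainTheorem6:
  shows "\<not> E2_bi_Lipschitz side_lengths"
proof
  assume "E2_bi_Lipschitz side_lengths"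
  then obtain C where C: "C > 0"
    "\<And>A B. C * dist_E2 A B \<le> dist (side_lengths A) (side_lengths B)"
    unfolding E2_bi_Lipschitz_def by blast
  \<comment> \<open>The estimates below give \<open>C \<le> 2 * t\<close>, so any positive
    \<open>t\<close> below \<open>C / 2\<close> yields a contradiction.\<close>
  define t where "t = C / 4"
  have "t > 0" using C(1) by (simp add: t_def)
  have "midpoint_defect (isosceles 0) = 0"
    using norm_midpoint_defect_isosceles[of 0] by simp
  then have "t \<le> 2 * dist_E2 (isosceles 0) (isosceles t)"
    using norm_midpoint_defect_le_dist_E2[of "isosceles 0" "isosceles t"] \<open>t > 0\<close>
    by (simp add: norm_midpoint_defect_isosceles)
  then have "C * t \<le> 2 * (C * dist_E2 (isosceles 0) (isosceles t))"
    using C(1) by simp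
  also have "\<dots> \<le> 2 * t\<^sup>2"
    using C(2) dist_side_lengths_isosceles order_trans by fastforce
  finally have "C \<le> 2 * t"
    using \<open>t > 0\<close> by (simp add: power2_eq_square)
  then show False
    using C(1) by (simp add: t_def)
qed

end
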